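(* The generating function for the distribution of the first letter statistic on $\mathcal{S}_n(1243,1342)$ for $n\ge1$ is given by $$\sum_{n\ge1}\ \sum_{\pi\in\mathcal{S}_n(1243,1342)}v^{\pi_1}x^n=\frac{vx(2-3v-3x+3vx)+vx(v+x-vx)\left(vx+\sqrt{1-6vx+v^2x^2}\right)}{2(1-v-2x+vx)}.$$
   Context: $\mathcal{S}_n(\sigma,\tau)$ is the set of permutations $\pi=\pi_1\cdots\pi_n$ of $[n]$ avoiding both patterns $\sigma$ and $\tau$ (classical pattern avoidance). The first letter statistic is $\pi_1$. The identity is between formal power series in $x$ with coefficients rational functions of $v$; the square root is the power series with constant term $1$. *)

theory Defs
  imports
    "HOL-Library.Sublist"
    "HOL-Combinatorics.Multiset_Permutations"
    "HOL-Computational_Algebra.Computational_Algebra"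
begin

definition order_isomorphic :: "nat list \<Rightarrow> nat list \<Rightarrow> bool" where
  "order_isomorphic xs ys \<longleftrightarrow> length xs = length ys \<and>
     (\<forall>i<length xs. \<forall>j<length xs. xs ! i < xs ! j \<longleftrightarrow> ys ! i < ys ! j)"

text \<open>The sublists ranged over need not be contiguous.\<close>

definition contains_pattern :: "nat list \<Rightarrow> nat list \<Rightarrow> bool" where
  "contains_pattern p s \<longleftrightarrow> (\<exists>q. subseq q p \<and> order_isomorphic q s)"

text \<open>Permutations of \<open>{1..n}\<close> are written in one-line notation.\<close>

definition avoiding_perms :: "nat \<Rightarrow> nat list \<Rightarrow> nat list \<Rightarrow> nat list set" where
  "avoiding_perms n s t =
     {p \<in> permutations_of_set {1..n}. \<not> contains_pattern p s \<and> \<not> contains_pattern p t}"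

definition ratfun_var :: "rat poly fract" where
  "ratfun_var = to_fract [:0, 1:]"

text \<open>The first argument of \<^const>\<open>fps_radical\<close> prescribes the constant term of the root;
  the result is a square root exactly when the given series has constant term \<open>1\<close>.\<close>

definition fps_sqrt1 :: "'a::field_char_0 fps \<Rightarrow> 'a fps" where
  "fps_sqrt1 a = fps_radical (\<lambda>_ _. 1) 2 a"

lemma fps_sqrt1_iff:
  fixes a b :: "'a::field_char_0 fps"
  assumes "fps_nth a 0 = 1"
  shows "b = fps_sqrt1 a \<longleftrightarrow> b ^ 2 = a \<and> fps_nth b 0 = 1"
proof -
  have root: "fps_sqrt1 a ^ 2 = a"
    using power_radical[of a "\<lambda>_ _. 1" 1] assms
    by (simp add: fps_sqrt1_def numeral_2_eq_2)
  have const: "fps_nth (fps_sqrt1 a) 0 = 1"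
    by (simp add: fps_sqrt1_def)
  have "b = fps_sqrt1 a" if "b ^ 2 = a" "fps_nth b 0 = 1"
    using radical_unique[of "\<lambda>_ _. 1" 1 a b] assms that
    by (simp add: fps_sqrt1_def numeral_2_eq_2)
  with root const show ?thesis by blast
qed

end

theory Submission
  imports Defs
begin

text \<open>In both patterns \<open>1243\<close> and \<open>1342\<close> the letters after the \<open>1\<close> form a peak, a letter
  with a smaller letter somewhere on either side, and these are the two possible peaks.
  Hence a permutation avoids both exactly when, for every letter \<open>a\<close>, the larger letters to
  the right of \<open>a\<close> have no peak, that is, first decrease and then increase (a \<^emph>\<open>valley\<close> word).

  Words are built by inserting their letters from the largest to the smallest. A new smallest
  letter may be inserted exactly before a valley suffix, so a word whose longest valley suffix
  has length \<open>l\<close> has \<open>l + 1\<close> children. If \<open>l \<ge> 1\<close>, the longest valley suffixes of the children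
  have the lengths \<open>2, \<dots>, l, l + 1, l + 1\<close> (lemma \<open>sum_valley_suffix_insert_min\<close>): the number of
  extensions depends on \<open>l\<close> only, and the generating tree has one label, with the succession
  rule of the large Schroeder numbers.

  A permutation of \<open>[n]\<close> with first letter \<open>k\<close> avoids the patterns when the rest of it does and
  the \<open>n - k\<close> letters above \<open>k\<close> form a valley word. There are \<open>2 ^ (n - k - 1)\<close> such words
  (one if \<open>k = n\<close>), each with label \<open>n - k\<close>, and the remaining \<open>k - 1\<close> letters below \<open>k\<close> are
  inserted by \<open>k - 1\<close> steps in the tree (theorem \<open>card_first_letter\<close>).

  On the level of generating functions, put \<open>y = v x\<close> and let \<open>\<tau>\<^sub>l\<close> count the descendants of
  a node with label \<open>l\<close>, where \<open>y\<close> marks the depth. Subtracting the succession rules of two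
  consecutive labels gives a linear recurrence of order two in \<open>l\<close>. It is solved by a geometric
  sequence with ratio \<open>1 / u\<close>, where \<open>u\<^sup>2 = (1 + y) u - 2 y\<close> and \<open>u\<close> has constant term \<open>1\<close>;
  this is where \<open>\<surd>(1 - 6 y + y\<^sup>2)\<close> enters. Summing the geometric series
  \<open>\<Sum> x ^ l * 2 ^ (l - 1) * \<tau>\<^sub>l\<close> leaves a rational function of \<open>x\<close>, \<open>v\<close> and \<open>u\<close>.\<close>

section \<open>Words without an interior peak\<close>

definition valley :: "nat list \<Rightarrow> bool" where
  "valley w \<longleftrightarrow> (\<forall>b c d. subseq [b, c, d] w \<longrightarrow> b < c \<longrightarrow> \<not> d < c)"

lemma subseq_Cons_Cons_iff:
  "subseq (y # ys) (x # xs) \<longleftrightarrow> (y = x \<and> subseq ys xs) \<or> subseq (y # ys) xs"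
  by (metis subseq_Cons' subseq_Cons2_iff)

lemma subseq_set_subset: "subseq u w \<Longrightarrow> set u \<subseteq> set w"
  by (auto elim: list_emb_set)

lemma valley_subseq: "valley w \<Longrightarrow> subseq u w \<Longrightarrow> valley u"
  unfolding valley_def using subseq_order.order_trans by blast

lemma valley_append: "valley (u @ w) \<Longrightarrow> valley w"
  by (rule valley_subseq) auto

lemma sorted_iff_subseq:
  fixes w :: "nat list"
  shows "sorted w \<longleftrightarrow> (\<forall>c d. subseq [c, d] w \<longrightarrow> c \<le> d)"
proof (induction w)
  case (Cons a w)
  have "(\<forall>c d. subseq [c, d] (a # w) \<longrightarrow> c \<le> d) \<longleftrightarrow>
      (\<forall>d\<in>set w. a \<le> d) \<and> (\<forall>c d. subseq [c, d] w \<longrightarrow> c \<le> d)"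
    by (auto simp: subseq_Cons_Cons_iff subseq_singleton_left simp del: subseq_Cons2_iff)
  with Cons show ?case by simp
qed simp

lemma sorted_imp_valley: "sorted w \<Longrightarrow> valley w"
  unfolding valley_def sorted_iff_subseq
  by (metis leD subseq_Cons')

text \<open>If the first letter \<open>e\<close> of \<open>w\<close> is larger than \<open>b\<close>, then a descent \<open>c d\<close> in \<open>w\<close> gives the peak
  \<open>b c d\<close> for \<open>b < c\<close> and the peak \<open>b e c\<close> for \<open>c < b\<close>. If \<open>e\<close> is smaller than \<open>b\<close>, then a peak
  \<open>b c d\<close> gives the peak \<open>e c d\<close> inside \<open>w\<close>.\<close>

lemma valley_Cons_iff:
  assumes "distinct (b # w)"
  shows "valley (b # w) \<longleftrightarrow> sorted (b # w) \<or> (valley w \<and> w \<noteq> [] \<and> hd w < b)"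
proof (cases w)
  case Nil
  then show ?thesis using sorted_imp_valley[of "[b]"] by simp
next
  case (Cons e w')
  show ?thesis
  proof (cases "e < b")
    case True
    have "valley (b # w)" if v: "valley w"
      unfolding valley_def
    proof (intro allI impI)
      fix x c d assume s: "subseq [x, c, d] (b # w)" and "x < c"
      show "\<not> d < c"
      proof (cases "subseq [x, c, d] w")
        case True
        then show ?thesis using v \<open>x < c\<close> by (auto simp: valley_def)
      next
        case False
        with s have "x = b" "subseq [c, d] w"
          by (auto simp: subseq_Cons_Cons_iff simp del: subseq_Cons2_iff)
        moreover have "c \<noteq> e" using \<open>x < c\<close> \<open>x = b\<close> True by simp
        ultimately have "subseq [e, c, d] w"
          unfolding Cons by (auto simp: subseq_Cons_Cons_iff simp del: subseq_Cons2_iff)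
        moreover have "e < c" using True \<open>x < c\<close> \<open>x = b\<close> by simp
        ultimately show ?thesis using v by (auto simp: valley_def)
      qed
    qed
    moreover have "valley w" if "valley (b # w)"
      using that by (rule valley_subseq) auto
    ultimately show ?thesis using True Cons by auto
  next
    case False
    with assms Cons have be: "b < e" by auto
    have "sorted (b # w)" if v: "valley (b # w)"
    proof -
      have "c \<le> d" if "subseq [c, d] w" for c d
      proof (rule ccontr)
        assume "\<not> c \<le> d"
        hence dc: "d < c" by simp
        have "subseq [b, c, d] (b # w)" using that by simp
        with v dc have cb: "c \<le> b" unfolding valley_def by (meson not_le)
        with be have "subseq [c, d] w'"
          using that unfolding Cons
          by (auto simp: subseq_Cons_Cons_iff simp del: subseq_Cons2_iff)
        hence "c \<in> set w'" using subseq_set_subset by fastforce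
        hence "subseq [b, e, c] (b # w)"
          unfolding Cons by (simp add: subseq_singleton_left)
        with v be cb show False unfolding valley_def by (meson le_less_trans)
      qed
      hence "sorted w" by (simp add: sorted_iff_subseq)
      with be Cons show ?thesis by auto
    qed
    moreover have "\<not> hd w < b" using False Cons by simp
    ultimately show ?thesis using sorted_imp_valley by blast
  qed
qed

text \<open>The descent from \<open>D\<close> to \<open>E\<close> excludes that a suffix starting in \<open>D\<close> is increasing, so
  by \<open>valley_Cons_iff\<close> all of \<open>D\<close> belongs to the decreasing arm.\<close>

lemma valley_append_sorted_iff:
  assumes "distinct (D @ E)" "sorted E" "E \<noteq> []" "D \<noteq> [] \<Longrightarrow> hd E < last D"
  shows "valley (D @ E) \<longleftrightarrow> sorted_wrt (>) D"
  using assms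
proof (induction D)
  case Nil
  then show ?case by (simp add: sorted_imp_valley)
next
  case (Cons b D)
  have IH: "valley (D @ E) \<longleftrightarrow> sorted_wrt (>) D"
    using Cons by (cases "D = []") (auto simp: sorted_imp_valley)
  have ns: "\<not> sorted (b # D @ E)"
    using Cons.prems by (cases E; cases D rule: rev_cases) (auto simp: sorted_append)
  have "sorted_wrt (>) (b # D) \<longleftrightarrow> hd (D @ E) < b \<and> sorted_wrt (>) D"
    using Cons.prems by (cases D) (auto dest: less_trans)
  moreover have "valley (b # D @ E) \<longleftrightarrow> valley (D @ E) \<and> hd (D @ E) < b"
    using valley_Cons_iff[of b "D @ E"] ns Cons.prems(1,3) by (metis append_Cons append_is_Nil_conv)
  ultimately show ?case using IH by auto
qed

text \<open>A peak would need its top letter in the interior, so a largest letter stands at an end.\<close>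

lemma card_valley_permutations:
  assumes "finite A"
  shows "card {w \<in> permutations_of_set A. valley w} = 2 ^ (card A - 1)"
  using assms
proof (induction A rule: finite_linorder_max_induct)
  case empty
  have "{w \<in> permutations_of_set {}. valley w} = {[]}"
    by (auto simp: valley_def)
  then show ?case by simp
next
  case (insert m A)
  let ?V = "\<lambda>A. {w \<in> permutations_of_set A. valley w}"
  show ?case
  proof (cases "A = {}")
    case True
    have "?V {m} = {[m]}"
      by (auto simp: sorted_imp_valley permutations_of_set_singleton)
    then show ?thesis using True by simp
  next
    case False
    have front: "valley (m # w)" if "w \<in> ?V A" for w
    proof -
      have w: "w \<noteq> []" "distinct (m # w)" "\<forall>x\<in>set w. x < m"
        using that False insert.hyps by (auto simp: permutations_of_set_def)
      then have "hd w < m" by simp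
      with w show ?thesis using valley_Cons_iff[of m w] that by auto
    qed
    have at_end: "valley (w @ [m])" if w: "w \<in> ?V A" for w
      unfolding valley_def
    proof (intro allI impI)
      fix b c d assume s: "subseq [b, c, d] (w @ [m])" and "b < c"
      have c: "c \<le> m"
        using subseq_set_subset[OF s] w insert.hyps
        by (auto simp: permutations_of_set_def intro: less_imp_le)
      from s obtain xs ys where xy: "[b, c, d] = xs @ ys" "subseq xs w" "subseq ys [m]"
        by (auto elim: subseq_appendE)
      have "ys = [] \<or> ys = [m]"
        using xy(3) by (cases ys) (auto split: if_splits dest: list_emb_length)
      then show "\<not> d < c"
      proof
        assume "ys = []"
        with xy w \<open>b < c\<close> show ?thesis by (auto simp: valley_def)
      next
        assume "ys = [m]"
        with xy(1) have "d = m" by (metis append_butlast_last_id last.simps last_snoc list.distinct(1))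
        with c show ?thesis by simp
      qed
    qed
    have eq: "?V (insert m A) = (#) m ` ?V A \<union> (\<lambda>w. w @ [m]) ` ?V A"
    proof (intro equalityI subsetI)
      fix w assume w: "w \<in> ?V (insert m A)"
      hence dw: "set w = insert m A" "distinct w" and v: "valley w"
        by (auto simp: permutations_of_set_def)
      then obtain P S where w_eq: "w = P @ m # S"
        by (metis insertI1 split_list)
      have mA: "m \<notin> A" using insert.hyps by auto
      have PS: "set (P @ S) = A" "distinct (P @ S)"
        using dw w_eq mA by auto
      have vPS: "valley (P @ S)"
        using v by (rule valley_subseq) (auto simp: w_eq intro: list_emb_append_mono)
      have "P = [] \<or> S = []"
      proof (rule ccontr)
        assume "\<not> ?thesis"
        then obtain b P' d S' where "P = b # P'" "S = d # S'" by (meson list.exhaust)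
        moreover from this have "b < m" "d < m" using PS insert.hyps by auto
        moreover have "subseq [b, m, d] (b # P' @ m # d # S')"
          by (metis append_Nil list_emb_append2 subseq_Cons2 list_emb_Nil)
        ultimately show False using v unfolding valley_def w_eq by (auto simp del: subseq_Cons2_iff)
      qed
      then show "w \<in> (#) m ` ?V A \<union> (\<lambda>w. w @ [m]) ` ?V A"
        using PS vPS w_eq by (auto simp: permutations_of_set_def)
    next
      fix w assume "w \<in> (#) m ` ?V A \<union> (\<lambda>w. w @ [m]) ` ?V A"
      then show "w \<in> ?V (insert m A)"
        using front at_end insert.hyps by (auto simp: permutations_of_set_def)
    qed
    have fin: "finite (?V A)" by simp
    have "(#) m ` ?V A \<inter> (\<lambda>w. w @ [m]) ` ?V A = {}"
    proof -
      have False if "m # w = w' @ [m]" "w \<in> ?V A" "w' \<in> ?V A" for w w'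
        using that False insert.hyps
        by (cases w') (auto simp: permutations_of_set_def)
      then show ?thesis by blast
    qed
    then have "card (?V (insert m A)) = card ((#) m ` ?V A) + card ((\<lambda>w. w @ [m]) ` ?V A)"
      unfolding eq by (intro card_Un_disjoint) (use fin in auto)
    also have "\<dots> = 2 * card (?V A)"
      by (simp add: card_image inj_on_def)
    also have "\<dots> = 2 ^ (card (insert m A) - 1)"
      using insert False by (cases "card A") auto
    finally show ?thesis .
  qed
qed

section \<open>Avoidance and insertion of a new smallest letter\<close>

text \<open>The union of the two patterns: a peak \<open>b c d\<close> to the right of and above a letter \<open>a\<close>. The
  cases \<open>b < d\<close> and \<open>d < b\<close> are \<open>1243\<close> and \<open>1342\<close>.\<close>

definition avoids_raised_peak :: "nat list \<Rightarrow> bool" where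
  "avoids_raised_peak w \<longleftrightarrow>
     (\<forall>a b c d. subseq [a, b, c, d] w \<longrightarrow> a < b \<longrightarrow> a < d \<longrightarrow> b < c \<longrightarrow> \<not> d < c)"

lemma all_less_Suc_Suc_Suc_Suc_0:
  "(\<forall>i<Suc (Suc (Suc (Suc 0))). P i) \<longleftrightarrow> P 0 \<and> P 1 \<and> P 2 \<and> P 3"
  by (auto simp: less_Suc_eq numeral_2_eq_2 numeral_3_eq_3)

lemma contains_1243_iff:
  "contains_pattern p [1, 2, 4, 3] \<longleftrightarrow>
     (\<exists>a b c d. subseq [a, b, c, d] p \<and> a < b \<and> b < d \<and> d < c)"
proof -
  have iso: "order_isomorphic [a, b, c, d] [1, 2, 4, 3] \<longleftrightarrow> a < b \<and> b < d \<and> d < c" for a b c d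
    unfolding order_isomorphic_def by (simp add: all_less_Suc_Suc_Suc_Suc_0) arith
  have iso_iff: "order_isomorphic q [1, 2, 4, 3] \<longleftrightarrow>
     (\<exists>a b c d. q = [a, b, c, d] \<and> a < b \<and> b < d \<and> d < c)" for q
  proof -
    have "\<exists>a b c d. q = [a, b, c, d]" if "order_isomorphic q [1, 2, 4, 3]"
      using that by (auto simp: order_isomorphic_def length_Suc_conv)
    then show ?thesis using iso by blast
  qed
  show ?thesis unfolding contains_pattern_def iso_iff by blast
qed

lemma contains_1342_iff:
  "contains_pattern p [1, 3, 4, 2] \<longleftrightarrow>
     (\<exists>a b c d. subseq [a, b, c, d] p \<and> a < d \<and> d < b \<and> b < c)"
proof -
  have iso: "order_isomorphic [a, b, c, d] [1, 3, 4, 2] \<longleftrightarrow> a < d \<and> d < b \<and> b < c" for a b c d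
    unfolding order_isomorphic_def by (simp add: all_less_Suc_Suc_Suc_Suc_0) arith
  have iso_iff: "order_isomorphic q [1, 3, 4, 2] \<longleftrightarrow>
     (\<exists>a b c d. q = [a, b, c, d] \<and> a < d \<and> d < b \<and> b < c)" for q
  proof -
    have "\<exists>a b c d. q = [a, b, c, d]" if "order_isomorphic q [1, 3, 4, 2]"
      using that by (auto simp: order_isomorphic_def length_Suc_conv)
    then show ?thesis using iso by blast
  qed
  show ?thesis unfolding contains_pattern_def iso_iff by blast
qed

lemma avoids_raised_peak_iff:
  assumes "distinct p"
  shows "avoids_raised_peak p \<longleftrightarrow>
    \<not> contains_pattern p [1, 2, 4, 3] \<and> \<not> contains_pattern p [1, 3, 4, 2]"
proof -
  have "b \<noteq> d" if "subseq [a, b, c, d] p" for a b c d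
  proof -
    have "distinct [a, b, c, d]"
      using that assms by (metis subseq_conv_nths distinct_nthsI)
    then show ?thesis by auto
  qed
  then show ?thesis
    unfolding avoids_raised_peak_def contains_1243_iff contains_1342_iff
    by (smt (verit) less_trans linorder_neqE_nat)
qed

lemma avoiding_perms_eq:
  "avoiding_perms n [1, 2, 4, 3] [1, 3, 4, 2] =
     {p \<in> permutations_of_set {1..n}. avoids_raised_peak p}"
  unfolding avoiding_perms_def
  by (auto simp: avoids_raised_peak_iff permutations_of_set_def)

lemma avoids_raised_peak_subseq:
  "avoids_raised_peak w \<Longrightarrow> subseq u w \<Longrightarrow> avoids_raised_peak u"
  unfolding avoids_raised_peak_def using subseq_order.order_trans by blast

lemma valley_imp_avoids: "valley w \<Longrightarrow> avoids_raised_peak w"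
  unfolding avoids_raised_peak_def valley_def by (meson subseq_Cons')

lemma avoids_Cons_iff:
  "avoids_raised_peak (a # w) \<longleftrightarrow> avoids_raised_peak w \<and> valley (filter ((<) a) w)"
proof -
  have f: "subseq [b, c, d] (filter ((<) a) w) \<longleftrightarrow> subseq [b, c, d] w \<and> a < b \<and> a < c \<and> a < d"
    for b c d
  proof
    assume s: "subseq [b, c, d] (filter ((<) a) w)"
    have "subseq [b, c, d] w"
      using s subseq_filter_left subseq_order.order_trans by blast
    with subseq_set_subset[OF s] show "subseq [b, c, d] w \<and> a < b \<and> a < c \<and> a < d"
      by auto
  next
    assume "subseq [b, c, d] w \<and> a < b \<and> a < c \<and> a < d"
    then show "subseq [b, c, d] (filter ((<) a) w)"
      using subseq_filter[of "[b, c, d]" w "(<) a"] by simp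
  qed
  show ?thesis
  proof
    assume L: "avoids_raised_peak (a # w)"
    have "valley (filter ((<) a) w)"
      unfolding valley_def f using L
      by (metis avoids_raised_peak_def subseq_Cons2)
    moreover have "avoids_raised_peak w"
      using L by (rule avoids_raised_peak_subseq) auto
    ultimately show "avoids_raised_peak w \<and> valley (filter ((<) a) w)" by simp
  next
    assume R: "avoids_raised_peak w \<and> valley (filter ((<) a) w)"
    show "avoids_raised_peak (a # w)"
      unfolding avoids_raised_peak_def
    proof (intro allI impI)
      fix a' b c d
      assume "subseq [a', b, c, d] (a # w)" and less: "a' < b" "a' < d" "b < c"
      then consider "a' = a" "subseq [b, c, d] w" | "subseq [a', b, c, d] w"
        unfolding subseq_Cons_Cons_iff[of _ _ a] by blast
      then show "\<not> d < c"
      proof cases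
        case 1
        then have "subseq [b, c, d] (filter ((<) a) w)" using f less by simp
        with R less show ?thesis unfolding valley_def by blast
      next
        case 2
        with R less show ?thesis unfolding avoids_raised_peak_def by blast
      qed
    qed
  qed
qed

text \<open>A new smallest letter never takes part in a peak above another letter, so only the peaks to
  its own right matter.\<close>

lemma avoids_insert_min_iff:
  assumes "\<forall>x\<in>set (P @ S). c < x"
  shows "avoids_raised_peak (P @ c # S) \<longleftrightarrow> avoids_raised_peak (P @ S) \<and> valley S"
  using assms
proof (induction P)
  case Nil
  hence "filter ((<) c) S = S" by (auto simp: filter_id_conv)
  then show ?case by (simp add: avoids_Cons_iff)
qed (auto simp: avoids_Cons_iff)

section \<open>The longest valley suffix\<close>

text \<open>The length of the longest suffix that is a valley word. It is the label of a word in the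
  generating tree.\<close>

fun valley_suffix :: "nat list \<Rightarrow> nat" where
  "valley_suffix [] = 0"
| "valley_suffix (a # w) = (if valley (a # w) then Suc (length w) else valley_suffix w)"

fun descending_suffix :: "nat list \<Rightarrow> nat" where
  "descending_suffix [] = 0"
| "descending_suffix (a # w) =
     (if sorted_wrt (>) (a # w) then Suc (length w) else descending_suffix w)"

lemma valley_suffix_le: "valley_suffix w \<le> length w"
  by (induction w) auto

lemma valley_suffix_valley: "valley w \<Longrightarrow> valley_suffix w = length w"
  by (cases w) auto

lemma valley_suffix_append: "\<not> valley w \<Longrightarrow> valley_suffix (u @ w) = valley_suffix w"
  by (induction u) (auto dest: valley_append[of "_ # _" w, simplified])

lemma valley_iff_valley_suffix: "valley S \<longleftrightarrow> length S \<le> valley_suffix (P @ S)"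
proof
  show "length S \<le> valley_suffix (P @ S)" if "valley S"
    by (induction P) (auto simp: valley_suffix_valley that)
  show "valley S" if "length S \<le> valley_suffix (P @ S)"
  proof (rule ccontr)
    assume n: "\<not> valley S"
    then obtain a w where S: "S = a # w" by (cases S) (auto simp: valley_def)
    have "valley_suffix (P @ S) \<le> length w"
      using n valley_suffix_append[OF n] valley_suffix_le[of w] by (simp add: S)
    with that S show False by simp
  qed
qed

text \<open>A valley suffix longer than \<open>E\<close> consists of \<open>E\<close> and a decreasing suffix of \<open>P\<close>.\<close>

lemma valley_suffix_append_sorted:
  assumes "distinct (P @ E)" "sorted E" "E \<noteq> []" "P \<noteq> [] \<Longrightarrow> hd E < last P"
  shows "valley_suffix (P @ E) = descending_suffix P + length E"
  using assms
proof (induction P)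
  case Nil
  then show ?case by (simp add: valley_suffix_valley sorted_imp_valley)
next
  case (Cons a P)
  have "valley_suffix (P @ E) = descending_suffix P + length E"
    using Cons by (cases "P = []") auto
  with valley_append_sorted_iff[of "a # P" E] Cons.prems show ?case by simp
qed

lemma descending_suffix_snoc:
  assumes "distinct (P @ [b])"
  shows "descending_suffix (P @ [b]) =
    (if P = [] \<or> b < last P then Suc (descending_suffix P) else 1)"
  using assms
proof (induction P)
  case (Cons a P)
  show ?case
  proof (cases "P = []")
    case False
    have "sorted_wrt (>) (a # P @ [b]) \<longleftrightarrow> sorted_wrt (>) (a # P) \<and> b < last P"
      using False by (cases P rule: rev_cases) (auto simp: sorted_wrt_append intro: less_trans)
    with Cons False show ?thesis by auto
  qed (use Cons.prems in auto)
qed simp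

text \<open>The suffix \<open>E\<close> is the longest increasing one; the bottom of the longest valley suffix is
  its first letter.\<close>

lemma ex_maximal_sorted_suffix:
  assumes "distinct w" "w \<noteq> []"
  shows "\<exists>P E. w = P @ E \<and> sorted E \<and> E \<noteq> [] \<and> (P \<noteq> [] \<longrightarrow> hd E < last P)"
  using assms(2,1)
proof (induction w rule: list_nonempty_induct)
  case (single x)
  then show ?case by (metis append_Nil list.distinct(1) sorted1)
next
  case (cons x w)
  then obtain P E where PE: "w = P @ E" "sorted E" "E \<noteq> []" "P \<noteq> [] \<longrightarrow> hd E < last P"
    by auto
  show ?case
  proof (cases "P = [] \<and> x < hd E")
    case True
    then have "sorted (x # E)" using PE(2,3) by (cases E) (auto intro: less_imp_le order.trans)
    with True PE show ?thesis by (intro exI[of _ "[]"] exI[of _ "x # E"]) auto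
  next
    case False
    have "x \<noteq> hd E" if "P = []"
      using cons.prems PE that by (cases E) auto
    with False PE show ?thesis by (intro exI[of _ "x # P"] exI[of _ E]) auto
  qed
qed

text \<open>The insertion site is given by the length \<open>r\<close> of the suffix that follows it, because the
  admissible sites are those with \<open>r \<le> valley_suffix w\<close>.\<close>

definition insert_before_suffix :: "nat \<Rightarrow> nat \<Rightarrow> nat list \<Rightarrow> nat list" where
  "insert_before_suffix c r w = take (length w - r) w @ c # drop (length w - r) w"

lemma insert_before_suffix_append:
  "insert_before_suffix c (length S) (P @ S) = P @ c # S"
  by (simp add: insert_before_suffix_def)

text \<open>The succession rule of the generating tree, stated for sums over the children. Let \<open>q\<close> be the
  length of the longest increasing suffix \<open>E\<close>. A letter inserted to the
  left of the bottom of the valley and not next to it starts a peak with the two letters that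
  follow, so only the \<open>r\<close> letters after it remain a valley suffix; this gives the lengths
  \<open>q + 1, \<dots>, l\<close>. Inserted next to the bottom on either side, it becomes the new bottom and the
  valley grows to length \<open>l + 1\<close>. Inserted further to the right, it follows a letter that ends
  an ascent, so that the decreasing arm is this single letter and the length is \<open>r + 2\<close>; this
  gives the lengths \<open>2, \<dots>, q\<close>.\<close>

lemma sum_valley_suffix_insert_min:
  fixes f :: "nat \<Rightarrow> 'a :: comm_semiring_1"
  assumes "distinct w" "w \<noteq> []" "\<forall>x\<in>set w. c < x"
  shows "(\<Sum>r\<le>valley_suffix w. f (valley_suffix (insert_before_suffix c r w))) =
    (\<Sum>i=2..valley_suffix w. f i) + 2 * f (Suc (valley_suffix w))"
proof -
  obtain P E where PE: "w = P @ E" "sorted E" "E \<noteq> []" "P \<noteq> [] \<Longrightarrow> hd E < last P"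
    using ex_maximal_sorted_suffix[OF assms(1,2)] by auto
  define l where "l = valley_suffix w"
  define q where "q = length E"
  have l: "l = descending_suffix P + q"
    using valley_suffix_append_sorted[of P E] assms(1) PE by (simp add: l_def q_def)
  have q0: "q > 0" using PE by (simp add: q_def)
  have child_sorted: "valley_suffix (Q @ c # S) = descending_suffix Q + Suc (length S)"
    if "w = Q @ S" "sorted S" for Q S
  proof -
    have "sorted (c # S)" using that assms(3) by (auto intro: less_imp_le)
    moreover have "distinct (Q @ c # S)" using that assms by auto
    moreover have "c < last Q" if "Q \<noteq> []"
      using \<open>w = Q @ S\<close> assms(3) that by simp
    ultimately show ?thesis
      using valley_suffix_append_sorted[of Q "c # S"] by simp
  qed
  \<comment> \<open>sites to the left of the bottom and not next to it: the new letter starts a peak\<close>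
  have big: "valley_suffix (insert_before_suffix c r w) = r" if r: "q < r" "r \<le> l" for r
  proof -
    define S where "S = drop (length w - r) w"
    define Q where "Q = take (length w - r) w"
    have QS: "w = Q @ S" by (simp add: Q_def S_def)
    have len: "length S = r" using r valley_suffix_le[of w] by (simp add: S_def l_def)
    have ins: "insert_before_suffix c r w = Q @ c # S"
      using insert_before_suffix_append[of c S Q] QS len by simp
    have vS: "valley S" using valley_iff_valley_suffix[of S Q] QS len r by (simp add: l_def)
    have "\<exists>P1 P2. P = P1 @ P2 \<and> S = P2 @ E \<and> P2 \<noteq> []"
    proof -
      have "length E < length S" using len r q_def by simp
      moreover have "P @ E = Q @ S" using PE QS by simp
      then obtain us where "P = Q @ us \<and> us @ E = S \<or> P @ us = Q \<and> E = us @ S"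
        by (auto simp: append_eq_append_conv2)
      ultimately show ?thesis by (intro exI[of _ Q] exI[of _ us]) auto
    qed
    then obtain P1 P2 where P12: "P = P1 @ P2" "S = P2 @ E" "P2 \<noteq> []" by blast
    have "\<not> sorted S"
      using PE(3,4) P12 by (cases P2 rule: rev_cases; cases E) (auto simp: sorted_append)
    hence "\<not> sorted (c # S)" by simp
    moreover have "distinct (c # S)" using assms QS by auto
    moreover have "\<not> hd S < c" if "S \<noteq> []"
      using assms(3) QS that by (metis hd_in_set in_set_conv_decomp_last not_less_iff_gr_or_eq Un_iff set_append)
    ultimately have "\<not> valley (c # S)" using valley_Cons_iff[of c S] by auto
    then have "valley_suffix (Q @ c # S) = valley_suffix S"
      using valley_suffix_append by simp
    also have "\<dots> = r" using valley_suffix_valley vS len by simp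
    finally show ?thesis using ins by simp
  qed
  \<comment> \<open>the two sites next to the bottom are \<open>r = q\<close> and \<open>r = q - 1\<close>\<close>
  have at_q: "valley_suffix (insert_before_suffix c q w) = Suc l"
    using child_sorted[of P E] PE insert_before_suffix_append[of c E P] l
    by (simp add: q_def)
  have below: "valley_suffix (insert_before_suffix c r w) =
      (if Suc r = q then Suc l else r + 2)" if r: "r < q" for r
  proof -
    define S where "S = drop (q - r) E"
    define E' where "E' = take (q - Suc r) E"
    define b where "b = E ! (q - Suc r)"
    have E: "E = E' @ b # S"
      using r id_take_nth_drop[of "q - Suc r" E]
      by (simp add: E'_def b_def S_def q_def Suc_diff_Suc)
    have len: "length S = r" using r by (simp add: S_def q_def)
    have ins: "insert_before_suffix c r w = (P @ E' @ [b]) @ c # S"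
      using insert_before_suffix_append[of c S "P @ E' @ [b]"] PE(1) E len by simp
    have "sorted S" using PE(2) E by (simp add: sorted_append)
    then have vs: "valley_suffix (insert_before_suffix c r w) =
        descending_suffix ((P @ E') @ [b]) + Suc r"
      using child_sorted[of "P @ E' @ [b]" S] PE(1) E ins len by simp
    have d: "distinct ((P @ E') @ [b])" using assms(1) PE E by auto
    show ?thesis
    proof (cases "Suc r = q")
      case True
      then have E': "E' = []" by (simp add: E'_def)
      have "P = [] \<or> b < last P" using PE(4) E E' by auto
      then show ?thesis using vs descending_suffix_snoc[OF d] E' True l by simp
    next
      case False
      have E': "E' \<noteq> []" using E len q_def False r by auto
      have "last E' \<in> set E'" using E' by simp
      then have "last E' \<le> b" using PE(2) E by (auto simp: sorted_append)
      then have "\<not> b < last (P @ E')" using E' by simp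
      then show ?thesis using vs descending_suffix_snoc[OF d] E' False by simp
    qed
  qed
  have ql: "q \<le> l" using l by simp
  let ?g = "\<lambda>r. f (valley_suffix (insert_before_suffix c r w))"
  obtain q' where q': "q = Suc q'" using q0 by (cases q) auto
  have split: "{..l} = {..<q'} \<union> {q', q} \<union> {Suc q..l}"
    using ql q' by auto
  have "(\<Sum>r\<le>l. ?g r) = (\<Sum>r<q'. ?g r) + (?g q' + ?g q) + (\<Sum>r=Suc q..l. ?g r)"
    unfolding split using q' by (subst sum.union_disjoint; (subst sum.union_disjoint)?) auto
  also have "(\<Sum>r<q'. ?g r) = (\<Sum>r<q'. f (r + 2))"
    using below q' by (intro sum.cong) auto
  also have "\<dots> = (\<Sum>i=2..q. f i)"
    by (rule sum.reindex_bij_witness[of _ "\<lambda>i. i - 2" "\<lambda>r. r + 2"]) (use q' in auto)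
  also have "?g q' + ?g q = 2 * f (Suc l)"
    using below[of q'] at_q q' by (simp add: mult_2)
  also have "(\<Sum>r=Suc q..l. ?g r) = (\<Sum>i=Suc q..l. f i)"
    using big by (intro sum.cong) auto
  also have "(\<Sum>i=2..q. f i) + 2 * f (Suc l) + (\<Sum>i=Suc q..l. f i) =
      ((\<Sum>i=2..q. f i) + (\<Sum>i=Suc q..l. f i)) + 2 * f (Suc l)"
    by (simp add: algebra_simps)
  also have "(\<Sum>i=2..q. f i) + (\<Sum>i=Suc q..l. f i) = (\<Sum>i=2..l. f i)"
  proof -
    have "(\<Sum>i=2..q. f i) + (\<Sum>i=Suc q..l. f i) = sum f ({2..q} \<union> {Suc q..l})"
      by (rule sum.union_disjoint[symmetric]) auto
    moreover have "{2..q} \<union> {Suc q..l} = {2..l}" using ql q0 by auto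
    ultimately show ?thesis by simp
  qed
  finally show ?thesis by (simp add: l_def)
qed


section \<open>Counting by the first letter\<close>

text \<open>The number of nodes \<open>j\<close> levels below a node with label \<open>l\<close> in the generating tree with the
  succession rule \<open>(0) \<rightarrow> (1)\<close> and \<open>(l) \<rightarrow> (2) \<dots> (l) (l + 1) (l + 1)\<close> for \<open>l \<ge> 1\<close>; the label \<open>0\<close>
  belongs to the empty word.\<close>

fun descendants :: "nat \<Rightarrow> nat \<Rightarrow> nat" where
  "descendants 0 l = 1"
| "descendants (Suc j) l =
     (if l = 0 then descendants j 1 else (\<Sum>i=2..l. descendants j i) + 2 * descendants j (Suc l))"

text \<open>For letters \<open>C\<close> below those of \<open>u\<close>, these are the words reached from \<open>u\<close> by inserting the letters
  of \<open>C\<close> from the largest to the smallest. Describing them by the subword \<open>u\<close> avoids any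
  relabelling of letters.\<close>

definition extensions :: "nat list \<Rightarrow> nat set \<Rightarrow> nat list set" where
  "extensions u C = {w \<in> permutations_of_set (set u \<union> C).
     avoids_raised_peak w \<and> filter (\<lambda>x. x \<in> set u) w = u}"

lemma set_insert_before_suffix: "set (insert_before_suffix c r u) = insert c (set u)"
proof -
  have "set u = set (take (length u - r) u) \<union> set (drop (length u - r) u)"
    by (metis append_take_drop_id set_append)
  then show ?thesis by (auto simp: insert_before_suffix_def)
qed

lemma filter_insert_before_suffix:
  assumes "c \<notin> set u"
  shows "filter (\<lambda>x. x \<in> set u) (insert_before_suffix c r u) = u"
proof -
  have "filter (\<lambda>x. x \<in> set u) (take (length u - r) u) @
      filter (\<lambda>x. x \<in> set u) (drop (length u - r) u) =
      filter (\<lambda>x. x \<in> set u) (take (length u - r) u @ drop (length u - r) u)"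
    by (rule filter_append[symmetric])
  also have "\<dots> = u" by (simp add: filter_id_conv)
  finally show ?thesis using assms unfolding insert_before_suffix_def by simp
qed

lemma insert_before_suffix_inj:
  assumes "insert_before_suffix c r u = insert_before_suffix c s u"
    and "c \<notin> set u" "r \<le> length u" "s \<le> length u"
  shows "r = s"
proof -
  have "takeWhile (\<lambda>x. x \<noteq> c) (insert_before_suffix c r u) = take (length u - r) u" for r
  proof -
    have "\<forall>x\<in>set (take (length u - r) u). x \<noteq> c"
      using assms(2) by (auto dest: in_set_takeD)
    then show ?thesis by (simp add: insert_before_suffix_def takeWhile_append)
  qed
  with assms(1) have "take (length u - r) u = take (length u - s) u" by metis
  then have "length u - r = length u - s"
    by (metis length_take min.absorb2 diff_le_self)
  with assms show ?thesis by simp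
qed

lemma finite_extensions [simp]: "finite C \<Longrightarrow> finite (extensions u C)"
  by (simp add: extensions_def)

text \<open>The letters of \<open>w\<close> in \<open>u\<close> together with \<open>c\<close> form a child of \<open>u\<close>, because avoidance passes
  to subwords.\<close>

lemma extensions_insert:
  assumes "distinct u" "\<forall>x\<in>set u. c < x"
  shows "extensions u (insert c C) =
    (\<Union>r\<le>valley_suffix u. extensions (insert_before_suffix c r u) C)"
proof (intro equalityI subsetI)
  have c: "c \<notin> set u" using assms by auto
  fix w assume w: "w \<in> extensions u (insert c C)"
  then have dw: "distinct w" and sw: "set w = set u \<union> insert c C"
    and aw: "avoids_raised_peak w" and fw: "filter (\<lambda>x. x \<in> set u) w = u"
    by (auto simp: extensions_def permutations_of_set_def)
  define v where "v = filter (\<lambda>x. x \<in> insert c (set u)) w"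
  have dv: "distinct v" using dw by (simp add: v_def)
  have sv: "set v = insert c (set u)" using sw by (auto simp: v_def)
  then obtain P S where PS: "v = P @ c # S" by (metis insertI1 split_list)
  have "filter (\<lambda>x. x \<in> set u) v = u"
    using fw by (simp add: v_def) (metis (mono_tags, lifting) filter_cong)
  moreover have "set P \<union> set S \<subseteq> set u" using sv dv unfolding PS by auto
  then have "filter (\<lambda>x. x \<in> set u) P = P" "filter (\<lambda>x. x \<in> set u) S = S"
    by (auto simp: filter_id_conv)
  ultimately have u: "u = P @ S" using c by (simp add: PS)
  have "avoids_raised_peak v"
    using aw by (rule avoids_raised_peak_subseq) (simp add: v_def)
  then have "valley S" using avoids_insert_min_iff[of P S c] assms(2) u PS by simp
  then have "length S \<le> valley_suffix u" using valley_iff_valley_suffix u by blast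
  moreover have "v = insert_before_suffix c (length S) u"
    by (simp add: PS u insert_before_suffix_append)
  then have "w \<in> extensions (insert_before_suffix c (length S) u) C"
    using dw sw aw v_def unfolding extensions_def set_insert_before_suffix
    by (auto simp: permutations_of_set_def)
  ultimately show "w \<in> (\<Union>r\<le>valley_suffix u. extensions (insert_before_suffix c r u) C)"
    by auto
next
  have c: "c \<notin> set u" using assms by auto
  fix w assume "w \<in> (\<Union>r\<le>valley_suffix u. extensions (insert_before_suffix c r u) C)"
  then obtain r where w: "w \<in> extensions (insert_before_suffix c r u) C" by auto
  then have fw: "filter (\<lambda>x. x \<in> insert c (set u)) w = insert_before_suffix c r u"
    by (simp add: extensions_def set_insert_before_suffix)
  have "filter (\<lambda>x. x \<in> set u) w = filter (\<lambda>x. x \<in> set u) (filter (\<lambda>x. x \<in> insert c (set u)) w)"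
    by (simp add: conj_commute) (metis (mono_tags, lifting) filter_cong)
  also have "\<dots> = u" unfolding fw by (rule filter_insert_before_suffix[OF c])
  finally show "w \<in> extensions u (insert c C)"
    using w by (simp add: extensions_def set_insert_before_suffix)
qed

theorem card_extensions:
  assumes "finite C" "distinct u" "avoids_raised_peak u" "\<forall>c\<in>C. \<forall>x\<in>set u. c < x"
  shows "card (extensions u C) = descendants (card C) (valley_suffix u)"
  using assms
proof (induction C arbitrary: u rule: finite_linorder_max_induct)
  case empty
  have "w = u" if "set w = set u" "filter (\<lambda>x. x \<in> set u) w = u" for w
    using that filter_id_conv by metis
  then have "extensions u {} = {u}"
    using empty by (auto simp: extensions_def permutations_of_set_def filter_id_conv)
  then show ?case by simp
next
  case (insert c C)
  let ?ins = "\<lambda>r. insert_before_suffix c r u"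
  have c: "c \<notin> set u" "\<forall>x\<in>set u. c < x" using insert.prems by auto
  have child: "card (extensions (?ins r) C) = descendants (card C) (valley_suffix (?ins r))"
    if r: "r \<le> valley_suffix u" for r
  proof (rule insert.IH)
    define P S where PS: "P = take (length u - r) u" "S = drop (length u - r) u"
    have u: "u = P @ S" by (simp add: PS)
    have "length S = r" using r valley_suffix_le[of u] by (simp add: PS)
    then have ins: "?ins r = P @ c # S" and "valley S"
      using u insert_before_suffix_append[of c S P] valley_iff_valley_suffix[of S P] r by simp_all
    then show "avoids_raised_peak (?ins r)"
      using avoids_insert_min_iff[of P S c] c u insert.prems by simp
    show "distinct (?ins r)" using c insert.prems u ins by auto
    show "\<forall>d\<in>C. \<forall>x\<in>set (?ins r). d < x"
      using insert.prems insert.hyps by (auto simp: set_insert_before_suffix)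
  qed
  have disj: "extensions (?ins r) C \<inter> extensions (?ins s) C = {}"
    if "r \<le> valley_suffix u" "s \<le> valley_suffix u" "r \<noteq> s" for r s
  proof -
    have "?ins r = ?ins s" if "w \<in> extensions (?ins r) C" "w \<in> extensions (?ins s) C" for w
      using that by (simp add: extensions_def set_insert_before_suffix)
    moreover have "r \<le> length u" "s \<le> length u"
      using that valley_suffix_le[of u] by auto
    ultimately show ?thesis using insert_before_suffix_inj c(1) that(3) by blast
  qed
  have "card (extensions u (insert c C)) = (\<Sum>r\<le>valley_suffix u. card (extensions (?ins r) C))"
    unfolding extensions_insert[OF insert.prems(1) c(2)]
    using insert.hyps disj by (intro card_UN_disjoint) auto
  also have "\<dots> = (\<Sum>r\<le>valley_suffix u. descendants (card C) (valley_suffix (?ins r)))"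
    using child by (intro sum.cong) auto
  also have "\<dots> = descendants (card (insert c C)) (valley_suffix u)"
  proof (cases "u = []")
    case True
    have "valley [c]" by (simp add: sorted_imp_valley)
    moreover have "c \<notin> C" using insert.hyps by auto
    ultimately show ?thesis using True insert.hyps by (simp add: insert_before_suffix_def)
  next
    case False
    have "valley_suffix u \<noteq> 0"
    proof -
      obtain P x where "u = P @ [x]" using False by (metis rev_exhaust)
      moreover have "valley [x]" by (simp add: sorted_imp_valley)
      ultimately show ?thesis using valley_iff_valley_suffix[of "[x]" P] by auto
    qed
    moreover have "c \<notin> C" using insert.hyps by auto
    ultimately show ?thesis
      using sum_valley_suffix_insert_min[OF insert.prems(1) False c(2), of "descendants (card C)"]
        insert.hyps by simp
  qed
  finally show ?case .
qed

text \<open>Deleting the first letter \<open>k\<close> leaves an extension, by the letters below \<open>k\<close>, of a valley word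
  on the letters above \<open>k\<close>. With truncated subtraction the factor is \<open>1\<close> for \<open>k = n\<close>, where
  that valley word is empty.\<close>

theorem card_first_letter:
  assumes "1 \<le> k" "k \<le> n"
  shows "card {p \<in> permutations_of_set {1..n}. avoids_raised_peak p \<and> hd p = k} =
    2 ^ (n - k - 1) * descendants (k - 1) (n - k)"
proof -
  let ?V = "{u \<in> permutations_of_set {k<..n}. valley u}"
  let ?W = "\<Union>u\<in>?V. extensions u {1..<k}"
  have un: "insert k ({k<..n} \<union> {1..<k}) = {1..n}" "k \<notin> {k<..n} \<union> {1..<k}"
    using assms by auto
  have "{p \<in> permutations_of_set {1..n}. avoids_raised_peak p \<and> hd p = k} = (#) k ` ?W"
  proof (intro equalityI subsetI)
    fix p assume p: "p \<in> {p \<in> permutations_of_set {1..n}. avoids_raised_peak p \<and> hd p = k}"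
    then have "p \<noteq> []" using assms
      by (auto simp: permutations_of_set_def)
    with p obtain w where w: "p = k # w" by (cases p) auto
    have dw: "distinct (k # w)" "set (k # w) = {1..n}" and aw: "avoids_raised_peak (k # w)"
      using p w by (auto simp: permutations_of_set_def)
    then have sw: "set w = {k<..n} \<union> {1..<k}" using un by auto
    define u where "u = filter ((<) k) w"
    have su: "set u = {k<..n}" using sw by (auto simp: u_def)
    have "filter (\<lambda>x. x \<in> set u) w = u"
      unfolding u_def by (rule filter_cong) auto
    moreover have "u \<in> ?V" "avoids_raised_peak w"
      using su dw aw by (auto simp: permutations_of_set_def avoids_Cons_iff u_def)
    ultimately show "p \<in> (#) k ` ?W"
      using su sw dw by (auto simp: w extensions_def permutations_of_set_def)
  next
    fix p assume "p \<in> (#) k ` ?W"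
    then obtain w u where p: "p = k # w" and u: "u \<in> ?V" and w: "w \<in> extensions u {1..<k}"
      by auto
    have su: "set u = {k<..n}" using u by (simp add: permutations_of_set_def)
    have sw: "set w = {k<..n} \<union> {1..<k}" "distinct w"
      using w su by (auto simp: extensions_def permutations_of_set_def)
    have "filter ((<) k) w = filter (\<lambda>x. x \<in> set u) w"
      using su sw by (intro filter_cong) auto
    also have "\<dots> = u" using w by (simp add: extensions_def)
    finally have "avoids_raised_peak (k # w)"
      using u w by (simp add: avoids_Cons_iff extensions_def)
    moreover have "set (k # w) = {1..n}" "distinct (k # w)"
      using sw un by auto
    ultimately show "p \<in> {p \<in> permutations_of_set {1..n}. avoids_raised_peak p \<and> hd p = k}"
      using p by (simp add: permutations_of_set_def)
  qed
  then have "card {p \<in> permutations_of_set {1..n}. avoids_raised_peak p \<and> hd p = k} = card ?W"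
    by (simp add: card_image)
  also have "\<dots> = (\<Sum>u\<in>?V. card (extensions u {1..<k}))"
  proof (rule card_UN_disjoint)
    show "\<forall>u\<in>?V. \<forall>u'\<in>?V. u \<noteq> u' \<longrightarrow> extensions u {1..<k} \<inter> extensions u' {1..<k} = {}"
      by (auto simp: extensions_def permutations_of_set_def)
  qed auto
  also have "\<dots> = (\<Sum>u\<in>?V. descendants (k - 1) (n - k))"
  proof (rule sum.cong)
    fix u assume u: "u \<in> ?V"
    then have su: "set u = {k<..n}" and du: "distinct u" and vu: "valley u"
      by (auto simp: permutations_of_set_def)
    have "length u = n - k" using distinct_card[OF du] su by simp
    then have "valley_suffix u = n - k" using valley_suffix_valley[OF vu] by simp
    moreover have "card (extensions u {1..<k}) = descendants (card {1..<k}) (valley_suffix u)"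
      using su du vu by (intro card_extensions valley_imp_avoids) auto
    ultimately show "card (extensions u {1..<k}) = descendants (k - 1) (n - k)" by simp
  qed simp
  also have "\<dots> = 2 ^ (n - k - 1) * descendants (k - 1) (n - k)"
    using card_valley_permutations[of "{k<..n}"] by simp
  finally show ?thesis .
qed

lemma sum_first_letter:
  fixes v :: "'a :: comm_semiring_1"
  assumes "n \<ge> 1"
  shows "(\<Sum>p | p \<in> permutations_of_set {1..n} \<and> avoids_raised_peak p. v ^ hd p) =
    (\<Sum>k=1..n. of_nat (2 ^ (n - k - 1) * descendants (k - 1) (n - k)) * v ^ k)"
proof -
  let ?A = "{p \<in> permutations_of_set {1..n}. avoids_raised_peak p}"
  have fin: "finite ?A" by simp
  have hd: "hd ` ?A \<subseteq> {1..n}"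
  proof
    fix k assume "k \<in> hd ` ?A"
    then obtain p where p: "p \<in> ?A" "k = hd p" by auto
    then have "set p = {1..n}" by (auto simp: permutations_of_set_def)
    moreover from this have "p \<noteq> []" using assms by auto
    ultimately show "k \<in> {1..n}" using p(2) hd_in_set by metis
  qed
  have "(\<Sum>p\<in>?A. v ^ hd p) = (\<Sum>k=1..n. \<Sum>p\<in>{p\<in>?A. hd p = k}. v ^ hd p)"
    by (rule sum.group[symmetric]) (use fin hd in auto)
  also have "\<dots> = (\<Sum>k=1..n. of_nat (2 ^ (n - k - 1) * descendants (k - 1) (n - k)) * v ^ k)"
  proof (rule sum.cong)
    fix k assume k: "k \<in> {1..n}"
    have "(\<Sum>p\<in>{p\<in>?A. hd p = k}. v ^ hd p) = of_nat (card {p\<in>?A. hd p = k}) * v ^ k"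
      by simp
    then show "(\<Sum>p\<in>{p\<in>?A. hd p = k}. v ^ hd p) =
        of_nat (2 ^ (n - k - 1) * descendants (k - 1) (n - k)) * v ^ k"
      using card_first_letter[of k n] k by (simp add: conj_assoc)
  qed simp
  finally show ?thesis .
qed

section \<open>Generating functions\<close>

text \<open>The solution with constant term \<open>1\<close> of \<open>u\<^sup>2 = (1 + y) u - 2 y\<close> for \<open>y = v x\<close>. Its inverse is
  the ratio of the geometric sequence of descendant generating functions. The other root
  \<open>1 + y - u\<close> has constant term \<open>0\<close>, so its inverse is not a power series.\<close>

definition schroeder_root :: "'a :: field_char_0 \<Rightarrow> 'a fps" where
  "schroeder_root v = (let y = fps_const v * fps_X in
     fps_const (1 / 2) * (1 + y + fps_sqrt1 (1 - 6 * y + y ^ 2)))"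

lemma schroeder_root:
  fixes v :: "'a :: field_char_0"
  defines "y \<equiv> fps_const v * fps_X"
  shows "schroeder_root v ^ 2 = (1 + y) * schroeder_root v - 2 * y"
    and "fps_nth (schroeder_root v) 0 = 1"
    and "fps_sqrt1 (1 - 6 * y + y ^ 2) = 2 * schroeder_root v - 1 - y"
proof -
  let ?R = "fps_sqrt1 (1 - 6 * y + y ^ 2)"
  let ?h = "fps_const (1 / 2 :: 'a)"
  have y0: "fps_nth y 0 = 0" by (simp add: y_def)
  have R: "?R ^ 2 = 1 - 6 * y + y ^ 2" "fps_nth ?R 0 = 1"
    using fps_sqrt1_iff[of "1 - 6 * y + y ^ 2" ?R] y0 by (simp_all add: power2_eq_square)
  have h: "2 * ?h = 1"
    by (simp add: numeral_fps_const)
  have u: "schroeder_root v = ?h * (1 + y + ?R)"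
    by (simp add: schroeder_root_def Let_def y_def)
  show "schroeder_root v ^ 2 = (1 + y) * schroeder_root v - 2 * y"
    using u h R(1) by algebra
  show "fps_nth (schroeder_root v) 0 = 1"
    using u y0 R(2) by simp
  show "?R = 2 * schroeder_root v - 1 - y"
    using u h by algebra
qed

text \<open>The succession rule determines its solution coefficient by coefficient, so it suffices to
  check that the geometric sequence satisfies it: for \<open>l = 1\<close> this fixes the initial value
  \<open>1 / (u - y)\<close>, and the differences of consecutive labels reduce to the quadratic equation
  for \<open>u\<close>.\<close>

lemma descendants_generating_function:
  fixes v :: "'a :: field_char_0"
  defines "y \<equiv> fps_const v * fps_X" and "u \<equiv> schroeder_root v"
  shows "Abs_fps (\<lambda>j. of_nat (descendants j (Suc l)) * v ^ j) = inverse (u - y) * inverse u ^ l"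
    and "Abs_fps (\<lambda>j. of_nat (descendants j 0) * v ^ j) = 1 + y * inverse (u - y)"
proof -
  define a where "a = inverse (u - y)"
  define b where "b = inverse u"
  have u: "u ^ 2 = (1 + y) * u - 2 * y" "fps_nth u 0 = 1" "fps_nth y 0 = 0"
    using schroeder_root[of v] by (simp_all add: u_def y_def)
  have a: "a * (u - y) = 1" and b: "b * u = 1"
    unfolding a_def b_def using u by (simp_all add: inverse_mult_eq_1)
  define g where "g l = (if l = 0 then 1 + y * a else a * b ^ (l - 1))" for l :: nat
  have base: "g 1 = 1 + y * (2 * g 2)"
  proof -
    have "a = 1 + y * (2 * (a * b))" using a b u(1) by algebra
    then show ?thesis by (simp add: g_def)
  qed
  have b2: "b - 1 = y * (2 * b ^ 2 - b)" using b u(1) by algebra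
  have g_rec: "g (Suc l) = 1 + y * ((\<Sum>i=2..Suc l. g i) + 2 * g (Suc (Suc l)))" for l
  proof (induction l)
    case 0
    then show ?case using base by (simp add: numeral_2_eq_2)
  next
    case (Suc l)
    have "g (Suc (Suc l)) - g (Suc l) = a * b ^ l * (b - 1)"
      by (simp add: g_def algebra_simps)
    also have "\<dots> = y * (2 * g (Suc (Suc (Suc l))) - g (Suc (Suc l)))"
      unfolding b2 by (simp add: g_def algebra_simps power2_eq_square)
    finally show ?case using Suc
      by (simp add: algebra_simps)
  qed
  have ynth: "fps_nth (y * f) 0 = 0" "fps_nth (y * f) (Suc j) = v * fps_nth f j" for f j
    by (simp_all add: y_def mult.assoc)
  have "fps_nth (g l) j = of_nat (descendants j l) * v ^ j" for l j
  proof (induction j arbitrary: l)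
    case 0
    then show ?case
    proof (cases l)
      case (Suc m)
      have "fps_nth (g (Suc m)) 0 = 1" by (subst g_rec) (simp add: u(3))
      then show ?thesis using Suc by simp
    qed (simp add: g_def u(3))
  next
    case (Suc j)
    note IH = Suc.IH
    show ?case
    proof (cases l)
      case 0
      then have "g l = 1 + y * g 1" by (simp add: g_def)
      then show ?thesis using 0 Suc[of 1] by (simp add: ynth)
    next
      case (Suc m)
      have two: "fps_nth (2 * f) j = 2 * fps_nth f j" for f :: "'a fps"
        by (metis mult_2 fps_add_nth)
      have "fps_nth (g l) (Suc j) = v * ((\<Sum>i=2..l. fps_nth (g i) j) + 2 * fps_nth (g (Suc l)) j)"
        unfolding Suc by (subst g_rec) (simp only: fps_add_nth fps_one_nth ynth fps_sum_nth two, simp)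
      also have "\<dots> = of_nat (descendants (Suc j) l) * v ^ Suc j"
        unfolding IH using Suc
        by (simp add: sum_distrib_right algebra_simps sum_distrib_left)
      finally show ?thesis .
    qed
  qed
  then have "Abs_fps (\<lambda>j. of_nat (descendants j l) * v ^ j) = g l" for l
    by (simp add: fps_eq_iff)
  then show "Abs_fps (\<lambda>j. of_nat (descendants j (Suc l)) * v ^ j) = inverse (u - y) * inverse u ^ l"
    and "Abs_fps (\<lambda>j. of_nat (descendants j 0) * v ^ j) = 1 + y * inverse (u - y)"
    by (simp_all add: g_def a_def b_def)
qed

text \<open>The right-hand side is a coefficient of \<open>\<Sum>l. x \<cdot> a \<cdot> (2 x / u) ^ l\<close>, whose ratio has zero
  constant term. The coefficient of \<open>x ^ n\<close> only sees the partial sum below \<open>n\<close>, because the remainder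
  is divisible by \<open>x ^ (n + 1)\<close>.\<close>

lemma sum_geometric_fps:
  fixes u a :: "'a :: field_char_0 fps"
  assumes "fps_nth u 0 = 1"
  shows "fps_nth (fps_X * a * u * inverse (u - 2 * fps_X)) n =
    (\<Sum>l<n. 2 ^ l * fps_nth (a * inverse u ^ l) (n - Suc l))"
proof -
  define b where "b = inverse u"
  define c where "c = inverse (u - 2 * fps_X)"
  define z where "z = 2 * fps_X * b"
  have b: "b * u = 1" and c: "c * (u - 2 * fps_X) = 1"
    unfolding b_def c_def using assms by (simp_all add: inverse_mult_eq_1 numeral_fps_const)
  have "(1 - z) * (u * c) = 1" using b c unfolding z_def by algebra
  moreover have "(1 - z) * (\<Sum>l<n. z ^ l) = 1 - z ^ n" 
    by (simp add: one_diff_power_eq)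
  moreover have "u * c = s + u * c * w" if "(1 - z) * (u * c) = 1" "(1 - z) * s = 1 - w" for s w
    using that by algebra
  ultimately have "u * c = (\<Sum>l<n. z ^ l) + u * c * z ^ n" by blast
  then have "fps_X * a * (u * c) = fps_X * a * ((\<Sum>l<n. z ^ l) + u * c * z ^ n)" by metis
  also have "\<dots> = (\<Sum>l<n. fps_X * a * z ^ l) + fps_X ^ Suc n * (a * u * c * (2 * b) ^ n)"
    by (simp add: z_def algebra_simps sum_distrib_left power_mult_distrib)
  finally have "fps_nth (fps_X * a * (u * c)) n = (\<Sum>l<n. fps_nth (fps_X * a * z ^ l) n)"
    by (simp only: fps_add_nth fps_sum_nth fps_X_power_mult_nth) simp
  also have "\<dots> = (\<Sum>l<n. 2 ^ l * fps_nth (a * b ^ l) (n - Suc l))"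
  proof (rule sum.cong)
    fix l assume l: "l \<in> {..<n}"
    have "(2 :: 'a fps) ^ l = fps_const (2 ^ l)"
      by (simp only: numeral_fps_const fps_const_power)
    moreover have "fps_X * a * z ^ l = fps_X ^ Suc l * (2 ^ l * (a * b ^ l))"
      by (simp add: z_def power_mult_distrib mult_ac)
    ultimately have "fps_X * a * z ^ l = fps_X ^ Suc l * (fps_const (2 ^ l) * (a * b ^ l))"
      by metis
    then show "fps_nth (fps_X * a * z ^ l) n = 2 ^ l * fps_nth (a * b ^ l) (n - Suc l)"
      using l by (simp only: fps_X_power_mult_nth fps_mult_left_const_nth) auto
  qed simp
  finally show ?thesis by (simp add: b_def c_def mult.assoc)
qed

text \<open>The coefficients are regrouped by the label \<open>l = n - k\<close> of the valley word, the factor \<open>y\<close>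
  standing for the first letter.\<close>

lemma first_letter_generating_function:
  fixes v :: "'a :: field_char_0"
  defines "x \<equiv> fps_X" and "y \<equiv> fps_const v * fps_X" and "u \<equiv> schroeder_root v"
  shows "Abs_fps (\<lambda>n. \<Sum>k=1..n. of_nat (2 ^ (n - k - 1) * descendants (k - 1) (n - k)) * v ^ k) =
    y * (1 + y * inverse (u - y) + x * inverse (u - y) * u * inverse (u - 2 * x))"
    (is "?F = y * ?H")
proof -
  let ?f = "\<lambda>n k. of_nat (2 ^ (n - k - 1) * descendants (k - 1) (n - k)) * v ^ k :: 'a"
  have u0: "fps_nth u 0 = 1" using schroeder_root by (simp add: u_def)
  have H: "fps_nth ?H n = (\<Sum>l\<le>n. 2 ^ (l - 1) * (of_nat (descendants (n - l) l) * v ^ (n - l)))" for n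
  proof -
    have H: "fps_nth ?H n = fps_nth (1 + y * inverse (u - y)) n +
        (\<Sum>l<n. 2 ^ l * fps_nth (inverse (u - y) * inverse u ^ l) (n - Suc l))"
      unfolding x_def by (subst fps_add_nth, subst sum_geometric_fps[OF u0]) simp
    have "1 + y * inverse (u - y) = Abs_fps (\<lambda>j. of_nat (descendants j 0) * v ^ j)"
      using descendants_generating_function(2)[of v] by (simp add: u_def y_def)
    moreover have "(\<Sum>l<n. 2 ^ l * fps_nth (inverse (u - y) * inverse u ^ l) (n - Suc l)) =
        (\<Sum>l<n. 2 ^ l * (of_nat (descendants (n - Suc l) (Suc l)) * v ^ (n - Suc l)))"
      by (simp add: u_def y_def descendants_generating_function(1)[symmetric])
    ultimately have "fps_nth ?H n = of_nat (descendants n 0) * v ^ n +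
        (\<Sum>l<n. 2 ^ l * (of_nat (descendants (n - Suc l) (Suc l)) * v ^ (n - Suc l)))"
      unfolding H by (simp only: fps_nth_Abs_fps)
    then show ?thesis unfolding sum.atMost_shift by simp
  qed
  have "fps_nth ?F n = fps_nth (y * ?H) n" for n
  proof (cases n)
    case 0
    then show ?thesis by (simp add: y_def)
  next
    case (Suc m)
    have "fps_nth ?F n = (\<Sum>k=1..n. ?f n k)" by simp
    also have "\<dots> = (\<Sum>l\<le>m. ?f n (n - l))"
      by (rule sum.reindex_bij_witness[of _ "\<lambda>l. n - l" "\<lambda>k. n - k"]) (use Suc in auto)
    also have "\<dots> = v * (\<Sum>l\<le>m. 2 ^ (l - 1) * (of_nat (descendants (m - l) l) * v ^ (m - l)))"
      unfolding sum_distrib_left by (rule sum.cong) (use Suc in \<open>auto simp: Suc_diff_le\<close>)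
    also have "\<dots> = fps_nth (y * ?H) n"
      unfolding H[symmetric] by (simp add: Suc y_def mult.assoc)
    finally show ?thesis .
  qed
  then show ?thesis by (simp add: fps_eq_iff)
qed

lemma ratfun_var_neq_1: "ratfun_var \<noteq> 1"
proof -
  have "[:0, 1:] \<noteq> (1 :: rat poly)" by (simp add: one_pCons)
  then show ?thesis unfolding ratfun_var_def by (metis to_fract_1 to_fract_eq_iff)
qed

text \<open>The denominator factors as \<open>x (1 - v - 2 x + y) = - (u - 2 x) (u' - 2 x) / 2\<close>, where
  \<open>u' = 1 + y - u\<close> is the conjugate of \<open>u\<close> and \<open>u u' = 2 y\<close>. This cancels \<open>u - 2 x\<close>, and after
  multiplication by \<open>x\<close> the claim is an identity modulo the quadratic equation for \<open>u\<close>. For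
  \<open>v = 1\<close> the denominator would not be a unit.\<close>

lemma first_letter_closed_form:
  fixes v0 :: "'a :: field_char_0"
  assumes "v0 \<noteq> 1"
  defines "v \<equiv> fps_const v0" and "x \<equiv> fps_X"
  shows "Abs_fps (\<lambda>n. \<Sum>k=1..n. of_nat (2 ^ (n - k - 1) * descendants (k - 1) (n - k)) * v0 ^ k) =
    (v * x * (2 - 3 * v - 3 * x + 3 * v * x)
       + v * x * (v + x - v * x) * (v * x + fps_sqrt1 (1 - 6 * v * x + v^2 * x^2)))
    / (2 * (1 - v - 2 * x + v * x))"
    (is "?F = ?N / ?D")
proof -
  define y where "y = v * x"
  define u where "u = schroeder_root v0"
  define a where "a = inverse (u - y)"
  define c where "c = inverse (u - 2 * x)"
  have x0: "fps_nth x 0 = 0" "fps_nth y 0 = 0" by (simp_all add: x_def y_def)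
  have u: "u ^ 2 = (1 + y) * u - 2 * y" "fps_nth u 0 = 1"
    and R: "fps_sqrt1 (1 - 6 * y + y ^ 2) = 2 * u - 1 - y"
    using schroeder_root[of v0] by (simp_all add: u_def y_def v_def x_def)
  have a: "a * (u - y) = 1" and c: "c * (u - 2 * x) = 1"
    unfolding a_def c_def using u x0
    by (simp_all add: inverse_mult_eq_1 numeral_fps_const)
  have F: "?F = y * (1 + y * a + x * a * u * c)"
    using first_letter_generating_function[of v0]
    by (simp add: y_def v_def x_def u_def a_def c_def)
  have N: "?N = y * (2 - 3 * v - 3 * x + 3 * y) + y * (v + x - y) * (2 * u - 1)"
    using R by (simp add: y_def mult.assoc power_mult_distrib)
  have "x * (y * (1 + y * a + x * a * u * c) * ?D) =
      x * (y * (2 - 3 * v - 3 * x + 3 * y) + y * (v + x - y) * (2 * u - 1))"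
  proof -
    have xD: "x * ?D = - (u - 2 * x) * (1 + y - u - 2 * x)"
      using u(1) y_def by algebra
    have au: "1 + y * a = a * u" using a by algebra
    have "x * (y * (1 + y * a + x * a * u * c) * ?D) =
        - y * a * (u * (1 + y - u - 2 * x)) * ((u - 2 * x) + x * (c * (u - 2 * x)))"
      using xD unfolding au by algebra
    also have "\<dots> = 2 * y * (a * ((x * u - y) * (u - x)))"
    proof -
      have "u * (1 + y - u - 2 * x) = 2 * y - 2 * x * u" using u(1) by algebra
      then show ?thesis unfolding c by algebra
    qed
    also have "(x * u - y) * (u - x) =
        (u - y) * (x - 2 * y - 2 * x ^ 2 + 2 * x * y + u * (y + x ^ 2 - x * y))"
      using u(1) by algebra
    also have "a * ((u - y) * (x - 2 * y - 2 * x ^ 2 + 2 * x * y + u * (y + x ^ 2 - x * y))) =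
        x - 2 * y - 2 * x ^ 2 + 2 * x * y + u * (y + x ^ 2 - x * y)"
      using a by algebra
    also have "2 * y * \<dots> =
        x * (y * (2 - 3 * v - 3 * x + 3 * y) + y * (v + x - y) * (2 * u - 1))"
      using y_def by algebra
    finally show ?thesis .
  qed
  moreover have "x \<noteq> 0" by (simp add: x_def)
  ultimately have FD: "?F * ?D = ?N" unfolding F N by simp
  have "fps_nth ?D 0 \<noteq> 0"
    using assms(1) x0 by (simp add: v_def y_def numeral_fps_const)
  then have "?D \<noteq> 0" by (metis fps_zero_nth)
  then have "?F * ?D / ?D = ?F" by (rule nonzero_mult_div_cancel_right)
  then show ?thesis unfolding FD by (rule sym)
qed

theorem corollary15:
  shows "Abs_fps (\<lambda>n. if n \<ge> 1
            then \<Sum>p\<in>avoiding_perms n [1, 2, 4, 3] [1, 3, 4, 2]. ratfun_var ^ hd p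
            else 0) =
    (let v = fps_const ratfun_var; x = fps_X in
      (v * x * (2 - 3 * v - 3 * x + 3 * v * x)
         + v * x * (v + x - v * x) * (v * x + fps_sqrt1 (1 - 6 * v * x + v^2 * x^2)))
      / (2 * (1 - v - 2 * x + v * x)))"
proof -
  have coeff: "(if n \<ge> 1
      then \<Sum>p\<in>avoiding_perms n [1, 2, 4, 3] [1, 3, 4, 2]. ratfun_var ^ hd p else 0) =
      (\<Sum>k=1..n. of_nat (2 ^ (n - k - 1) * descendants (k - 1) (n - k)) * ratfun_var ^ k)" for n
    unfolding avoiding_perms_eq using sum_first_letter[of n ratfun_var] by (cases "n \<ge> 1") simp_all
  show ?thesis
    unfolding coeff Let_def by (rule first_letter_closed_form[OF ratfun_var_neq_1])
qed
end
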